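(* Let $p_1,p_2,p_3,\ldots$ be numbers, let $n\geq 1$, and let $P_n$ be the $n\times n$ matrix whose $(i,j)$ entry is $p_{j-i+1}$ if $j\geq i$, is $-1$ if $i=j+1$, and is $0$ if $i>j+1$. Let the sequence $a_1,a_2,a_3,\ldots$ be defined by $a_1=1$ and $a_{m+1}=\sum_{i=1}^{m}p_{m-i+1}a_i$ for $m=1,2,\ldots$. Let $0\leq k\leq n$ and let $S_{n-k}$ be the sum of all principal minors of order $n-k$ of the matrix $P_n$. Then $$S_{n-k}=\sum_{j_1+j_2+\cdots+j_{k+1}=n-k}a_{j_1+1}a_{j_2+1}\cdots a_{j_{k+1}+1},$$ where the sum is taken over all integers $j_t\geq 0$ $(t=1,2,\ldots,k+1)$ with $j_1+\cdots+j_{k+1}=n-k$.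
   Context: The paper does not specify the nature of the numbers $p_i$; they may be taken to be complex numbers. A principal minor of order $n-k$ of $P_n$ is the determinant of the matrix obtained from $P_n$ by deleting the rows and columns with the same $k$ indices $1\leq i_1<\cdots<i_k\leq n$; the principal minor of order $0$ is $1$. *)

theory Defs
  imports
    "HOL-Library.FuncSet"
    "Jordan_Normal_Form.Determinant"
    "Jordan_Normal_Form.DL_Submatrix"
begin

(* Rows and columns of a matrix are numbered from 0, so the entry at (i, j) here is the entry
   at (i + 1, j + 1) in the usual numbering; the difference j - i is unaffected. The values of p
   used are p 1, ..., p n; p 0 never occurs. *)
definition P_mat :: "(nat \<Rightarrow> complex) \<Rightarrow> nat \<Rightarrow> complex mat" where
  "P_mat p n = mat n n (\<lambda>(i, j).
     if i \<le> j then p (j - i + 1) else if i = j + 1 then -1 else 0)"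

(* K is the set of deleted indices. The determinant of the 0 x 0 matrix is 1, so the principal
   minor of order 0 is 1. *)
definition principal_minor :: "complex mat \<Rightarrow> nat set \<Rightarrow> complex" where
  "principal_minor A K = det (submatrix A ({..<dim_row A} - K) ({..<dim_col A} - K))"

(* For an n x n matrix A and k \<le> n, the summands are the principal minors of order n - k. *)
definition sum_principal_minors_deleting :: "complex mat \<Rightarrow> nat \<Rightarrow> complex" where
  "sum_principal_minors_deleting A k =
     (\<Sum>K\<in>{K. K \<subseteq> {..<dim_row A} \<and> card K = k}. principal_minor A K)"

end

theory Submission
  imports Defs "HOL-Computational_Algebra.Formal_Power_Series"
begin

text \<open>
  Let \<open>F\<^sub>k\<close> be the generating function, over \<open>n\<close>, of the sum of all principal
  minors obtained from the n-by-n matrix by deleting \<open>k\<close> indices. Either the last index is deleted,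
  or one expands repeatedly along the last row: below the diagonal this row contains only the
  entry \<open>-1\<close>, present exactly when the preceding index is kept. With \<open>P\<close> and \<open>A\<close> the generating
  functions of the \<open>p\<close> and of the shifted \<open>a\<close>, this gives
  \<open>F\<^sub>k = X F\<^sub>k\<^sub>-\<^sub>1 + P F\<^sub>k\<close> for \<open>k > 0\<close> and \<open>F\<^sub>0 = 1 + P F\<^sub>0\<close>, while the recurrence for \<open>a\<close> says
  \<open>A = 1 + P A\<close>. Hence \<open>F\<^sub>k = X\<^sup>k A\<^sup>k\<^sup>+\<^sup>1\<close>.
\<close>

section \<open>Determinants on a set of kept indices, with a bordering column\<close>

lemma pick_insert_less:
  assumes "S \<subseteq> {..<n}" "i < card S"
  shows "pick (insert n S) i = pick S i"
proof -
  have S: "pick S i \<in> S" "pick S i < n"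
    using assms pick_in_set_le[of i S] by auto
  then have "{a \<in> insert n S. a < pick S i} = {a \<in> S. a < pick S i}"
    by auto
  then show ?thesis
    using pick_card_in_set[of "pick S i" "insert n S"] S card_pick_le[OF assms(2)] by simp
qed

lemma pick_insert_card:
  assumes "S \<subseteq> {..<n}"
  shows "pick (insert n S) (card S) = n"
proof -
  have "{a \<in> insert n S. a < n} = S"
    using assms by auto
  then show ?thesis
    using pick_card_in_set[of n "insert n S"] by simp
qed

text \<open>The set \<open>S\<close> holds the kept indices, and \<open>q\<close> is an entry
  function on all naturals rather than a matrix, so the value does not depend on an ambient size and
  recurs unchanged for every \<open>n\<close>.\<close>

definition principal_det :: "(nat \<Rightarrow> nat \<Rightarrow> 'a :: comm_ring_1) \<Rightarrow> nat set \<Rightarrow> 'a" where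
  "principal_det q S = det (mat (card S) (card S) (\<lambda>(i, j). q (pick S i) (pick S j)))"

text \<open>
  The last row has index \<open>n\<close>, but the last column is an arbitrary \<open>c\<close>: this class of determinants
  is closed under deletion of the last row and the last but one column.
\<close>
definition bordered_det ::
  "(nat \<Rightarrow> nat \<Rightarrow> 'a :: comm_ring_1) \<Rightarrow> (nat \<Rightarrow> 'a) \<Rightarrow> nat \<Rightarrow> nat set \<Rightarrow> 'a" where
  "bordered_det q c n S = det (mat (Suc (card S)) (Suc (card S)) (\<lambda>(i, j).
     if j < card S then q (pick (insert n S) i) (pick S j) else c (pick (insert n S) i)))"

lemma principal_det_empty [simp]: "principal_det q {} = 1"
  by (simp add: principal_det_def)

lemma principal_det_insert:
  assumes "S \<subseteq> {..<n}"
  shows "principal_det q (insert n S) = bordered_det q (\<lambda>i. q i n) n S"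
proof -
  have "finite S" "n \<notin> S"
    using assms finite_subset by auto
  then have card: "card (insert n S) = Suc (card S)"
    by simp
  show ?thesis
    unfolding principal_det_def bordered_det_def card
    by (intro arg_cong[where f = det] cong_mat)
      (auto simp: pick_insert_less[OF assms] pick_insert_card[OF assms] less_Suc_eq)
qed

lemma bordered_det_empty [simp]: "bordered_det q c n {} = c n"
proof -
  have "pick {n} 0 = n"
    using pick_insert_card[of "{}" n] by simp
  then show ?thesis
    unfolding bordered_det_def by (simp add: det_single)
qed

text \<open>Expansion along the last row, which has index \<open>n\<close>. Only the corner cofactor
  is evaluated; the others stay as they are because a Hessenberg \<open>q\<close> kills all but at
  most one of their coefficients.\<close>

lemma bordered_det_laplace:
  assumes "S \<subseteq> {..<n}"
  shows "bordered_det q c n S = c n * principal_det q S +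
    (\<Sum>j<card S. q n (pick S j) * cofactor (mat (Suc (card S)) (Suc (card S)) (\<lambda>(i, j).
       if j < card S then q (pick (insert n S) i) (pick S j) else c (pick (insert n S) i)))
       (card S) j)"
proof -
  let ?m = "card S"
  let ?A = "mat (Suc ?m) (Suc ?m) (\<lambda>(i, j).
     if j < ?m then q (pick (insert n S) i) (pick S j) else c (pick (insert n S) i))"
  have "mat_delete ?A ?m ?m = mat ?m ?m (\<lambda>(i, j). q (pick S i) (pick S j))"
    by (rule eq_matI) (auto simp: mat_delete_def pick_insert_less[OF assms])
  then have "cofactor ?A ?m ?m = principal_det q S"
    by (simp add: cofactor_def principal_det_def flip: mult_2)
  moreover have "bordered_det q c n S = (\<Sum>j<Suc ?m. ?A $$ (?m, j) * cofactor ?A ?m j)"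
    unfolding bordered_det_def by (rule laplace_expansion_row) auto
  ultimately show ?thesis
    by (simp add: pick_insert_card[OF assms] add.commute)
qed

text \<open>Index \<open>n\<close> is deleted, so all columns from \<open>S\<close> lie at least two
  places left of the diagonal entry of row \<open>Suc n\<close>. Only the corner survives.\<close>

lemma bordered_det_Suc_notin:
  assumes S: "S \<subseteq> {..<n}" and hess: "\<And>i j. j + 1 < i \<Longrightarrow> q i j = 0"
  shows "bordered_det q c (Suc n) S = c (Suc n) * principal_det q S"
proof -
  have "q (Suc n) (pick S j) = 0" if "j < card S" for j
    using pick_in_set_le[OF that] S by (intro hess) auto
  then show ?thesis
    using S by (subst bordered_det_laplace) auto
qed

text \<open>Index \<open>n\<close> is kept, so row \<open>Suc n\<close> also meets the subdiagonal
  entry in column \<open>n\<close>. Removing that row and column makes \<open>n\<close> the last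
  row, with the same border \<open>c\<close>.\<close>

lemma bordered_det_Suc_insert:
  assumes S: "S \<subseteq> {..<n}" and hess: "\<And>i j. j + 1 < i \<Longrightarrow> q i j = 0"
  shows "bordered_det q c (Suc n) (insert n S) =
    c (Suc n) * principal_det q (insert n S) - q (Suc n) n * bordered_det q c n S"
proof -
  let ?S = "insert n S"
  let ?m = "card S"
  have "finite S" "n \<notin> S"
    using S finite_subset by auto
  then have card: "card ?S = Suc ?m"
    by simp
  have S': "?S \<subseteq> {..<Suc n}"
    using S by auto
  let ?A = "mat (Suc (Suc ?m)) (Suc (Suc ?m)) (\<lambda>(i, j).
     if j < Suc ?m then q (pick (insert (Suc n) ?S) i) (pick ?S j)
     else c (pick (insert (Suc n) ?S) i))"
  have pick: "pick (insert (Suc n) ?S) i = pick ?S i" if "i < Suc ?m" for i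
    using that card by (intro pick_insert_less[OF S']) auto
  have zero: "q (Suc n) (pick ?S j) = 0" if "j < ?m" for j
    using pick_insert_less[OF S that] pick_in_set_le[OF that] S by (intro hess) auto
  have "mat_delete ?A (Suc ?m) ?m = mat (Suc ?m) (Suc ?m) (\<lambda>(i, j).
     if j < ?m then q (pick ?S i) (pick S j) else c (pick ?S i))"
    by (rule eq_matI) (auto simp: mat_delete_def pick pick_insert_less[OF S])
  \<comment> \<open>The position \<open>(Suc ?m, ?m)\<close> has odd index sum, hence the minus
    sign.\<close>
  then have "cofactor ?A (Suc ?m) ?m = - bordered_det q c n S"
    by (simp add: cofactor_def bordered_det_def flip: mult_2)
  then show ?thesis
    using bordered_det_laplace[OF S', of q c]
    by (simp add: card zero pick_insert_card[OF S])
qed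

section \<open>Sums of principal minors and their recurrence\<close>

text \<open>Here \<open>k\<close> counts deleted indices. The additive condition avoids truncated
  subtraction and makes the sum empty for \<open>k > n\<close>.\<close>

definition sum_principal_dets :: "(nat \<Rightarrow> nat \<Rightarrow> 'a :: comm_ring_1) \<Rightarrow> nat \<Rightarrow> nat \<Rightarrow> 'a" where
  "sum_principal_dets q n k = (\<Sum>S | S \<subseteq> {..<n} \<and> card S + k = n. principal_det q S)"

lemma sum_principal_dets_0:
  "sum_principal_dets q 0 k = (if k = 0 then 1 else 0)"
proof -
  have "{S. S = {} \<and> card S + k = 0} = (if k = 0 then {{} :: nat set} else {})"
    by auto
  then show ?thesis
    by (simp add: sum_principal_dets_def)
qed

lemma sum_subsets_Suc:
  fixes f :: "nat set \<Rightarrow> 'a :: comm_monoid_add"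
  shows "(\<Sum>S | S \<subseteq> {..<Suc n} \<and> card S + k = Suc n. f S) =
    (\<Sum>S | S \<subseteq> {..<n} \<and> card S + k = Suc n. f S) +
    (\<Sum>S | S \<subseteq> {..<n} \<and> card S + k = n. f (insert n S))"
proof -
  let ?B = "{S. S \<subseteq> {..<n} \<and> card S + k = Suc n}"
  let ?C = "{S. S \<subseteq> {..<n} \<and> card S + k = n}"
  have fin: "finite S" "n \<notin> S" if "S \<subseteq> {..<n}" for S
    using that finite_subset by auto
  have "{S. S \<subseteq> {..<Suc n} \<and> card S + k = Suc n} = ?B \<union> insert n ` ?C"
  proof (intro equalityI subsetI)
    fix S assume S: "S \<in> {S. S \<subseteq> {..<Suc n} \<and> card S + k = Suc n}"
    show "S \<in> ?B \<union> insert n ` ?C"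
    proof (cases "n \<in> S")
      case True
      have "finite S"
        using S finite_subset by auto
      with S True have "S = insert n (S - {n})" "S - {n} \<in> ?C"
        by (auto simp: lessThan_Suc dest: card_Suc_Diff1)
      then show ?thesis
        by blast
    next
      case False
      then show ?thesis
        using S by (auto simp: lessThan_Suc)
    qed
  qed (use fin in \<open>auto simp: lessThan_Suc\<close>)
  moreover have "inj_on (insert n) ?C"
    by (rule inj_onI) (use fin in \<open>auto simp: insert_ident\<close>)
  moreover have "?B \<inter> insert n ` ?C = {}"
    by auto
  moreover have "finite ?B" "finite ?C"
    by (auto intro: finite_subset[of _ "Pow {..<n}"])
  ultimately show ?thesis
    by (simp add: sum.union_disjoint sum.reindex)
qed

text \<open>With \<open>-1\<close> on the subdiagonal the signs cancel, so repeated expansion moves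
  the last row upwards while \<open>c\<close> stays fixed. When row \<open>i\<close> is last, the
  corner contributes \<open>c i\<close> times the full sum of minors on the first \<open>i\<close>
  indices.\<close>

lemma sum_bordered_dets:
  assumes hess: "\<And>i j. j + 1 < i \<Longrightarrow> q i j = 0" and sub: "\<And>i. q (Suc i) i = -1"
  shows "(\<Sum>S | S \<subseteq> {..<n} \<and> card S + k = n. bordered_det q c n S) =
    (\<Sum>i\<le>n. c i * sum_principal_dets q i k)"
proof (induction n)
  case 0
  have "{S. S = {} \<and> card S + k = 0} = (if k = 0 then {{} :: nat set} else {})"
    by auto
  then show ?case
    by (simp add: sum_principal_dets_0)
next
  case (Suc n)
  have "(\<Sum>S | S \<subseteq> {..<Suc n} \<and> card S + k = Suc n. bordered_det q c (Suc n) S) =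
    (\<Sum>S | S \<subseteq> {..<n} \<and> card S + k = Suc n. c (Suc n) * principal_det q S) +
    (\<Sum>S | S \<subseteq> {..<n} \<and> card S + k = n.
       c (Suc n) * principal_det q (insert n S) + bordered_det q c n S)"
    unfolding sum_subsets_Suc
    by (intro arg_cong2[where f = "(+)"] sum.cong refl)
      (simp_all add: bordered_det_Suc_notin hess bordered_det_Suc_insert sub)
  \<comment> \<open>The corner terms with \<open>n\<close> deleted and with \<open>n\<close> kept
    together range over all admissible subsets of \<open>{..<Suc n}\<close>.\<close>
  also have "\<dots> = c (Suc n) * sum_principal_dets q (Suc n) k +
      (\<Sum>S | S \<subseteq> {..<n} \<and> card S + k = n. bordered_det q c n S)"
    unfolding sum_principal_dets_def sum_subsets_Suc
    by (simp add: sum.distrib sum_distrib_left algebra_simps)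
  finally show ?case
    using Suc.IH by simp
qed

text \<open>If index \<open>n\<close> is deleted, \<open>k - 1\<close> deletions remain; if it is
  kept, the border is column \<open>n\<close> of \<open>q\<close> itself.\<close>

lemma sum_principal_dets_Suc:
  assumes "\<And>i j. j + 1 < i \<Longrightarrow> q i j = 0" "\<And>i. q (Suc i) i = -1"
  shows "sum_principal_dets q (Suc n) k =
    (if k = 0 then 0 else sum_principal_dets q n (k - 1)) +
    (\<Sum>i\<le>n. q i n * sum_principal_dets q i k)"
proof -
  have "(\<Sum>S | S \<subseteq> {..<n} \<and> card S + k = n. principal_det q (insert n S)) =
    (\<Sum>S | S \<subseteq> {..<n} \<and> card S + k = n. bordered_det q (\<lambda>i. q i n) n S)"
    by (intro sum.cong refl) (simp add: principal_det_insert)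
  also have "\<dots> = (\<Sum>i\<le>n. q i n * sum_principal_dets q i k)"
    by (intro sum_bordered_dets assms)
  finally have ins: "(\<Sum>S | S \<subseteq> {..<n} \<and> card S + k = n. principal_det q (insert n S)) = \<dots>" .
  have le: "card S \<le> n" if "S \<subseteq> {..<n}" for S
    using card_mono[OF _ that] by simp
  have "{S. S \<subseteq> {..<n} \<and> card S + k = Suc n} =
    (if k = 0 then {} else {S. S \<subseteq> {..<n} \<and> card S + (k - 1) = n})"
    by (cases k) (auto dest: le)
  then show ?thesis
    unfolding sum_principal_dets_def[of q "Suc n"] sum_subsets_Suc ins
    by (simp add: sum_principal_dets_def)
qed

section \<open>Generating functions\<close>

unbundle fps_syntax
no_notation vec_index (infixl "$" 100)

text \<open>Induction on \<open>T\<close> by the Cauchy product. Extensionality fixes the values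
  outside \<open>T\<close>, so each tuple of exponents is counted once.\<close>

lemma fps_prod_nth_PiE:
  fixes f :: "'b \<Rightarrow> 'a :: comm_ring_1 fps"
  assumes "finite T"
  shows "(\<Prod>t\<in>T. f t) $ s =
    (\<Sum>j\<in>{j \<in> T \<rightarrow>\<^sub>E (UNIV :: nat set). (\<Sum>t\<in>T. j t) = s}. \<Prod>t\<in>T. f t $ j t)"
  using assms
proof (induction T arbitrary: s)
  case empty
  have "{j \<in> {\<lambda>_ :: 'b. undefined :: nat}. s = 0} = (if s = 0 then {\<lambda>_. undefined} else {})"
    by auto
  then show ?case
    by (simp add: eq_commute[of 0 s])
next
  case (insert x T)
  let ?J = "\<lambda>T s. {j \<in> T \<rightarrow>\<^sub>E (UNIV :: nat set). (\<Sum>t\<in>T. j t) = s}"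
  \<comment> \<open>Every exponent is bounded by the total \<open>s\<close>.\<close>
  have fin: "finite (?J T s)" for s
  proof (rule finite_subset)
    show "?J T s \<subseteq> T \<rightarrow>\<^sub>E {..s}"
      using insert.hyps by (auto simp: PiE_def Pi_def intro: member_le_sum)
    show "finite (T \<rightarrow>\<^sub>E {..s})"
      using insert.hyps by (intro finite_PiE) auto
  qed
  have upd: "(\<Sum>t\<in>T. if t = x then y else g t) = (\<Sum>t\<in>T. g t)" for y and g :: "'b \<Rightarrow> nat"
    using insert.hyps by (intro sum.cong) auto
  have upd': "(\<Prod>t\<in>T. f t $ (if t = x then y else g t)) = (\<Prod>t\<in>T. f t $ g t)"
    for y and g :: "'b \<Rightarrow> nat"
    using insert.hyps by (intro prod.cong) auto
  have "(\<Prod>t\<in>insert x T. f t) $ s = (\<Sum>y=0..s. \<Sum>g\<in>?J T (s - y). f x $ y * (\<Prod>t\<in>T. f t $ g t))"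
    using insert by (simp add: fps_mult_nth sum_distrib_left)
  also have "\<dots> = (\<Sum>(y, g)\<in>(SIGMA y:{0..s}. ?J T (s - y)). f x $ y * (\<Prod>t\<in>T. f t $ g t))"
    using fin by (simp add: sum.Sigma)
  \<comment> \<open>A tuple on \<open>insert x T\<close> splits into its value at \<open>x\<close>
    and a tuple on \<open>T\<close>, which must be reset to \<open>undefined\<close> at
    \<open>x\<close>.\<close>
  also have "\<dots> = (\<Sum>j\<in>?J (insert x T) s. \<Prod>t\<in>insert x T. f t $ j t)"
    using insert.hyps
    by (intro sum.reindex_bij_witness[where i = "\<lambda>j. (j x, j(x := undefined))"
          and j = "\<lambda>(y, g). g(x := y)"])
      (auto simp: upd upd' PiE_def extensional_def fun_eq_iff)
  finally show ?case .
qed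

lemma sum_principal_dets_toeplitz:
  fixes p a :: "nat \<Rightarrow> 'a :: comm_ring_1"
  defines "q \<equiv> \<lambda>i j. if i \<le> j then p (j - i + 1) else if i = j + 1 then -1 else 0"
  defines "A \<equiv> Abs_fps (\<lambda>m. a (m + 1))"
  assumes a1: "a 1 = 1"
    and rec: "\<And>m. m \<ge> 1 \<Longrightarrow> a (m + 1) = (\<Sum>i = 1..m. p (m - i + 1) * a i)"
  shows "Abs_fps (\<lambda>n. sum_principal_dets q n k) = fps_X ^ k * A ^ (k + 1)"
proof -
  \<comment> \<open>The constant term is 0, so coefficient \<open>Suc n\<close> of
    \<open>f * P\<close> involves only \<open>f $ 0\<close> to \<open>f $ n\<close>.\<close>
  define P where "P = Abs_fps (\<lambda>m. if m = 0 then 0 else p m)"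
  define F where "F k = Abs_fps (\<lambda>n. sum_principal_dets q n k)" for k
  have P_mult: "(f * P) $ Suc n = (\<Sum>i\<le>n. p (n - i + 1) * f $ i)" for f n
    unfolding fps_mult_nth by (auto simp: P_def atLeast0AtMost Suc_diff_le mult.commute intro!: sum.cong)
  have "A = 1 + A * P"
  proof (rule fps_ext)
    fix n show "A $ n = (1 + A * P) $ n"
    proof (cases n)
      case 0
      then show ?thesis
        using a1 by (simp add: A_def P_def)
    next
      case (Suc m)
      have "a (Suc m + 1) = (\<Sum>i = 1..Suc m. p (Suc m - i + 1) * a i)"
        by (rule rec) simp
      also have "\<dots> = (\<Sum>i\<le>m. p (m - i + 1) * a (i + 1))"
        by (rule sum.reindex_bij_witness[where i = Suc and j = "\<lambda>i. i - 1"]) auto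
      finally have "a (Suc m + 1) = \<dots>" .
      then show ?thesis
        unfolding Suc by (simp add: P_mult) (simp add: A_def)
    qed
  qed
  then have inv: "A * (1 - P) = 1"
    by (simp add: algebra_simps)
  have F_rec: "F k = (if k = 0 then 1 else fps_X * F (k - 1)) + F k * P" for k
  proof (rule fps_ext)
    fix n show "F k $ n = ((if k = 0 then 1 else fps_X * F (k - 1)) + F k * P) $ n"
    proof (cases n)
      case 0
      then show ?thesis
        by (simp add: F_def P_def sum_principal_dets_0)
    next
      case (Suc m)
      have "sum_principal_dets q (Suc m) k =
        (if k = 0 then 0 else sum_principal_dets q m (k - 1)) +
        (\<Sum>i\<le>m. p (m - i + 1) * sum_principal_dets q i k)"
        by (subst sum_principal_dets_Suc) (auto simp: q_def)
      then show ?thesis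
        unfolding Suc by (cases "k = 0") (simp_all add: P_mult, simp_all add: F_def)
    qed
  qed
  \<comment> \<open>Multiplying by \<open>A\<close>, the inverse of \<open>1 - P\<close>, solves for
    \<open>F k\<close> without division in the coefficient ring.\<close>
  have F_A: "F k = (if k = 0 then 1 else fps_X * F (k - 1)) * A" for k
  proof -
    have "F k = F k * (A * (1 - P))"
      by (simp only: inv mult_1_right)
    also have "\<dots> = F k * (1 - P) * A"
      by (simp only: mult_ac)
    also have "F k * (1 - P) = (if k = 0 then 1 else fps_X * F (k - 1))"
      using F_rec[of k] by (simp add: algebra_simps)
    finally show ?thesis .
  qed
  have "F k = fps_X ^ k * A ^ (k + 1)"
  proof (induction k)
    case 0
    then show ?case
      using F_A[of 0] by simp
  next
    case (Suc k)
    then show ?case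
      using F_A[of "Suc k"] by (simp add: mult_ac)
  qed
  then show ?thesis
    by (simp add: F_def)
qed

section \<open>Back to the matrix and its deleted indices\<close>

lemma sum_principal_minors_P_mat:
  assumes "k \<le> n"
  shows "sum_principal_minors_deleting (P_mat p n) k = sum_principal_dets
    (\<lambda>i j. if i \<le> j then p (j - i + 1) else if i = j + 1 then -1 else 0) n k"
proof -
  let ?q = "\<lambda>i j. if i \<le> j then p (j - i + 1) else if i = j + 1 then -1 else 0"
  have minor: "principal_minor (P_mat p n) K = principal_det ?q ({..<n} - K)" for K
  proof -
    let ?S = "{..<n} - K"
    have S: "{i. i < n \<and> i \<in> ?S} = ?S"
      by auto
    have pick: "pick ?S i < n" if "i < card ?S" for i
      using pick_in_set_le[OF that] by auto
    have "submatrix (P_mat p n) ?S ?S =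
        mat (card ?S) (card ?S) (\<lambda>(i, j). P_mat p n $$ (pick ?S i, pick ?S j))"
      unfolding submatrix_def P_mat_def dim_row_mat dim_col_mat S ..
    also have "\<dots> = mat (card ?S) (card ?S) (\<lambda>(i, j). ?q (pick ?S i) (pick ?S j))"
      by (intro cong_mat) (simp_all add: P_mat_def pick)
    finally show ?thesis
      by (simp add: principal_minor_def principal_det_def P_mat_def)
  qed
  have card: "card ({..<n} - K) = n - card K" if "K \<subseteq> {..<n}" for K
    using that by (simp add: card_Diff_subset finite_subset)
  have le: "card S \<le> n" if "S \<subseteq> {..<n}" for S
    using card_mono[OF _ that] by simp
  \<comment> \<open>Complementation exchanges deleted and kept sets; \<open>k \<le> n\<close> gives
    \<open>n - k + k = n\<close>.\<close>
  have "(\<Sum>K | K \<subseteq> {..<n} \<and> card K = k. principal_det ?q ({..<n} - K)) =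
    (\<Sum>S | S \<subseteq> {..<n} \<and> card S + k = n. principal_det ?q S)"
    by (rule sum.reindex_bij_witness[where i = "\<lambda>S. {..<n} - S" and j = "\<lambda>K. {..<n} - K"])
      (use assms in \<open>auto simp: card double_diff dest: le\<close>)
  then show ?thesis
    unfolding sum_principal_minors_deleting_def sum_principal_dets_def minor
    by (simp add: P_mat_def)
qed

theorem theorem2:
  fixes p a :: "nat \<Rightarrow> complex" and n k :: nat
  assumes "n \<ge> 1"
    and "a 1 = 1"
    and "\<And>m. m \<ge> 1 \<Longrightarrow> a (m + 1) = (\<Sum>i = 1..m. p (m - i + 1) * a i)"
    and "k \<le> n"
  shows "sum_principal_minors_deleting (P_mat p n) k =
    (\<Sum>j\<in>{j \<in> {1..k + 1} \<rightarrow>\<^sub>E (UNIV :: nat set). (\<Sum>t = 1..k + 1. j t) = n - k}.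
       \<Prod>t = 1..k + 1. a (j t + 1))"
proof -
  define A where "A = Abs_fps (\<lambda>m. a (m + 1))"
  have "sum_principal_minors_deleting (P_mat p n) k = (fps_X ^ k * A ^ (k + 1)) $ n"
    unfolding sum_principal_minors_P_mat[OF assms(4)] A_def
    by (subst sum_principal_dets_toeplitz[of a p k, symmetric]) (use assms(2,3) in auto)
  \<comment> \<open>The factor \<open>fps_X ^ k\<close> shifts the coefficient index from
    \<open>n\<close> to \<open>n - k\<close>; the power of \<open>A\<close> becomes a product over
    \<open>{1..k + 1}\<close>, ready for expansion into tuples.\<close>
  also have "\<dots> = (\<Prod>t\<in>{1..k + 1}. A) $ (n - k)"
    using assms(4) by (simp add: fps_X_power_mult_nth)
  also have "\<dots> = (\<Sum>j\<in>{j \<in> {1..k + 1} \<rightarrow>\<^sub>E (UNIV :: nat set). (\<Sum>t = 1..k + 1. j t) = n - k}.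
       \<Prod>t = 1..k + 1. A $ j t)"
    by (rule fps_prod_nth_PiE) simp
  finally show ?thesis
    by (simp add: A_def)
qed

end
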